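(* Let $\mu>0$ be a real number, and let $(n_k)_{k\in\mathbb{N}}$ be a sequence of positive integers such that $n_k=p_k^{j_k}$ for all $k$, where $p_k$ is a prime and $j_k\in\mathbb{N}$. Then $T_{n_k}(\mu)\to\infty$ as $j_k\to\infty$; that is, for every $E>0$ there exists $A>0$ such that, for every $k$, $j_k>A$ implies $T_{n_k}(\mu)>E$.
   Context: $\mathbb{N}$ is the set of positive integers. $\tau(n)$ denotes the number of positive divisors of the positive integer $n$. For real $\mu>0$ and a positive integer $n$, $$T_n(\mu)=\frac{\max_{1\le m\le n^{1/\mu}}\tau(n+m)}{\tau(n)},$$ where the maximum is over integers $m$ in the indicated range. Here $p_k$ denotes an arbitrary prime depending on $k$ (not the $k$-th prime). *)

theory Defs
  imports Complex_Main "HOL-Computational_Algebra.Primes"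
begin

definition tau :: "nat \<Rightarrow> nat" where
  "tau n = card {d. d dvd n}"

(* For n \<ge> 1 and \<mu> > 0 the set of shifts m is finite, and it contains m = 1
   because n powr (1 / \<mu>) \<ge> 1; so the maximum is a genuine one. *)
definition T :: "nat \<Rightarrow> real \<Rightarrow> real" where
  "T n \<mu> =
     real (Max ((\<lambda>m. tau (n + m)) ` {m::nat. 1 \<le> m \<and> real m \<le> real n powr (1 / \<mu>)}))
       / real (tau n)"

end

theory Submission
  imports Defs
begin

text \<open>
  Every interval of length \<open>M\<close> contains a multiple of \<open>M\<close>, and a multiple of \<open>M\<close> has at least
  as many divisors as \<open>M\<close>. With \<open>M = 6 ^ t\<close> and \<open>t = \<lfloor>j / (3 * \<mu>)\<rfloor>\<close>, the bound
  \<open>6 ^ t \<le> 2 powr (j / \<mu>) \<le> (p ^ j) powr (1 / \<mu>)\<close> holds uniformly in the prime \<open>p\<close>, so a number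
  with at least \<open>(t + 1)\<^sup>2\<close> divisors lies in the admissible range. This is quadratic in \<open>j\<close>,
  whereas \<open>p ^ j\<close> has only \<open>j + 1\<close> divisors.
\<close>

lemma tau_mono_dvd:
  assumes "a dvd b" "b > 0"
  shows "tau a \<le> tau b"
  unfolding tau_def
  using assms by (intro card_mono) (auto intro: dvd_trans)

lemma tau_pos:
  assumes "n > 0"
  shows "tau n > 0"
  using assms unfolding tau_def by (subst card_gt_0_iff) auto

lemma tau_prime_power_le:
  assumes "prime p"
  shows "tau (p ^ j) \<le> j + 1"
proof -
  have "{d. d dvd p ^ j} = (\<lambda>i. p ^ i) ` {..j}"
    using assms by (auto simp: divides_primepow_nat)
  then show ?thesis
    unfolding tau_def using card_image_le[of "{..j}" "\<lambda>i. p ^ i"] by simp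
qed

text \<open>The numbers \<open>2 ^ a * 3 ^ b\<close> with \<open>a\<close> and \<open>b\<close> at
  most \<open>t\<close> are distinct divisors. Using two primes makes the count quadratic in
  \<open>t\<close> rather than linear.\<close>

lemma tau_6_power_ge: "(t + 1)\<^sup>2 \<le> tau (6 ^ t)"
proof -
  let ?f = "\<lambda>(a, b). 2 ^ a * 3 ^ b :: nat"
  \<comment> \<open>The exponent of 2 recovers \<open>a\<close>; cancelling \<open>2 ^ a\<close>
    then leaves equal powers of 3.\<close>
  have mult: "multiplicity 2 (2 ^ a * 3 ^ b :: nat) = a" for a b
    by (rule multiplicity_eqI) (auto simp: prime_dvd_mult_iff prime_dvd_power_iff)
  have "inj_on ?f ({..t} \<times> {..t})"
  proof (rule inj_onI, clarify)
    fix a b c d :: nat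
    assume eq: "(2 ^ a * 3 ^ b :: nat) = 2 ^ c * 3 ^ d"
    then have "a = c" by (metis mult)
    with eq show "a = c \<and> b = d" by simp
  qed
  then have "card (?f ` ({..t} \<times> {..t})) = (t + 1)\<^sup>2"
    by (simp add: card_image power2_eq_square)
  moreover have "?f ` ({..t} \<times> {..t}) \<subseteq> {d. d dvd 6 ^ t}"
  proof -
    have "(2 ^ a * 3 ^ b :: nat) dvd 6 ^ t" if "a \<le> t" "b \<le> t" for a b
    proof -
      have "(2 ^ a * 3 ^ b :: nat) dvd 2 ^ t * 3 ^ t"
        using that by (intro mult_dvd_mono le_imp_power_dvd)
      then show ?thesis
        by (simp flip: power_mult_distrib)
    qed
    then show ?thesis by auto
  qed
  ultimately show ?thesis
    unfolding tau_def by (metis card_mono finite_divisors_nat zero_less_numeral zero_less_power)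
qed

lemma T_ge_tau_divide:
  assumes "n > 0" "M > 0" "real M \<le> real n powr (1 / \<mu>)"
  shows "T n \<mu> \<ge> real (tau M) / real (tau n)"
proof -
  let ?S = "{m::nat. 1 \<le> m \<and> real m \<le> real n powr (1 / \<mu>)}"
  \<comment> \<open>The distance from \<open>n\<close> to the next multiple of \<open>M\<close>
    strictly above it. If \<open>M\<close> divides \<open>n\<close>, this is \<open>M\<close> and
    not 0, so \<open>1 \<le> m \<le> M\<close> in every case.\<close>
  define m where "m = M - n mod M"
  have lt: "n mod M < M" using assms by simp
  have "n + m = M * (n div M + 1)"
    using lt mult_div_mod_eq[of M n] unfolding m_def distrib_left by linarith
  then have "tau M \<le> tau (n + m)"
    using assms by (intro tau_mono_dvd) auto
  moreover have "real m \<le> real M"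
    unfolding m_def by simp
  then have "m \<in> ?S"
    using lt assms(3) unfolding m_def by auto
  moreover have "?S \<subseteq> {..nat \<lfloor>real n powr (1 / \<mu>)\<rfloor>}"
    by (auto simp: le_nat_floor)
  then have "finite ?S"
    by (rule finite_subset) simp
  ultimately have "tau M \<le> Max ((\<lambda>m. tau (n + m)) ` ?S)"
    by (meson Max_ge finite_imageI imageI le_trans)
  then show ?thesis
    unfolding T_def by (intro divide_right_mono) auto
qed

text \<open>The bound is independent of \<open>p\<close>, as it must be since the prime varies with
  \<open>k\<close>. The constant is \<open>18 = 2 * 3\<^sup>2\<close>: the 3 comes from
  \<open>t\<close>, the 2 from \<open>j + 1 \<le> 2 * j\<close> for
  \<open>j \<ge> 1\<close>.\<close>

lemma T_prime_power_gt:
  assumes "\<mu> > 0" "prime p" "j \<ge> 1"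
  shows "T (p ^ j) \<mu> > real j / (18 * \<mu>\<^sup>2)"
proof -
  define t where "t = nat \<lfloor>real j / (3 * \<mu>)\<rfloor>"
  have t_le: "real t \<le> real j / (3 * \<mu>)" and t_gt: "real j / (3 * \<mu>) < real t + 1"
    unfolding t_def using assms(1) by (simp_all add: of_nat_floor)
  \<comment> \<open>Rounding 6 up to \<open>8 = 2 ^ 3\<close> gives a power of 2; this exponent 3 is
    cancelled by the 3 in \<open>t\<close>.\<close>
  have "real (6 ^ t) \<le> 8 ^ t"
    by (simp add: power_mono)
  also have "\<dots> = 2 powr (3 * real t)"
    by (simp add: powr_powr[symmetric] powr_realpow)
  also have "\<dots> \<le> 2 powr (real j * (1 / \<mu>))"
    using t_le assms(1) by (intro powr_mono) (auto simp: field_simps)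
  also have "\<dots> = (2 ^ j) powr (1 / \<mu>)"
    by (simp only: powr_powr[symmetric] powr_realpow zero_less_numeral)
  \<comment> \<open>The smallest prime is the worst case: \<open>p \<ge> 2\<close>.\<close>
  also have "\<dots> \<le> real (p ^ j) powr (1 / \<mu>)"
    using assms(1) prime_ge_2_nat[OF assms(2)] by (intro powr_mono2) (auto intro: power_mono)
  finally have le: "real (6 ^ t) \<le> real (p ^ j) powr (1 / \<mu>)" .
  have pos: "p ^ j > 0"
    using assms(2) prime_gt_0_nat by simp
  have "real j / (18 * \<mu>\<^sup>2) = (real j / (3 * \<mu>))\<^sup>2 / (2 * real j)"
    using assms by (simp add: field_simps power2_eq_square)
  also have "\<dots> < (real t + 1)\<^sup>2 / (2 * real j)"
    using assms t_gt by (intro divide_strict_right_mono power_strict_mono) auto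
  also have "\<dots> \<le> (real t + 1)\<^sup>2 / (real j + 1)"
    using assms(3) by (intro divide_left_mono) auto
  also have "\<dots> \<le> real (tau (6 ^ t)) / real (tau (p ^ j))"
  proof (rule frac_le)
    show "(real t + 1)\<^sup>2 \<le> real (tau (6 ^ t))"
      using of_nat_mono[OF tau_6_power_ge[of t], where 'a = real] by (simp add: add.commute)
    show "real (tau (p ^ j)) \<le> real j + 1"
      using of_nat_mono[OF tau_prime_power_le[OF assms(2), of j], where 'a = real]
      by (simp add: add.commute)
  qed (use tau_pos[OF pos] in auto)
  also have "\<dots> \<le> T (p ^ j) \<mu>"
    using T_ge_tau_divide[OF pos _ le] by simp
  finally show ?thesis .
qed

theorem theorem1p1:
  fixes \<mu> :: real and n p j :: "nat \<Rightarrow> nat"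
  assumes "\<mu> > 0"
    and "\<And>k. k \<ge> 1 \<Longrightarrow> prime (p k)"
    and "\<And>k. k \<ge> 1 \<Longrightarrow> j k \<ge> 1"
    and "\<And>k. k \<ge> 1 \<Longrightarrow> n k = p k ^ j k"
  shows "\<forall>E::real. E > 0 \<longrightarrow> (\<exists>A::real. A > 0 \<and>
           (\<forall>k\<ge>1. real (j k) > A \<longrightarrow> T (n k) \<mu> > E))"
proof (intro allI impI)
  fix E :: real assume "E > 0"
  \<comment> \<open>The threshold is the solution \<open>x\<close> of
    \<open>x / (18 * \<mu>\<^sup>2) = E\<close>.\<close>
  have "T (n k) \<mu> > E" if "k \<ge> 1" "real (j k) > 18 * \<mu>\<^sup>2 * E" for k
  proof -
    have "E < real (j k) / (18 * \<mu>\<^sup>2)"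
      using that(2) assms(1) by (simp add: field_simps)
    also have "\<dots> < T (n k) \<mu>"
      using T_prime_power_gt[OF assms(1) assms(2,3)[OF that(1)]] assms(4)[OF that(1)] by simp
    finally show ?thesis .
  qed
  then show "\<exists>A::real. A > 0 \<and> (\<forall>k\<ge>1. real (j k) > A \<longrightarrow> T (n k) \<mu> > E)"
    using \<open>E > 0\<close> assms(1) by (intro exI[of _ "18 * \<mu>\<^sup>2 * E"]) auto
qed

end
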